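(* The algebraic variety $\mathcal{J}^3$ of nilpotent complex Jordan algebra laws on $\mathbb{C}^3$ is irreducible (in the Zariski topology).
   Context: A complex Jordan algebra $J=(V,\varphi)$ is a complex vector space $V$ with a symmetric bilinear map $\varphi:V\times V\to V$ satisfying $\varphi(\varphi(x,x),\varphi(x,y))=\varphi(x,\varphi(\varphi(x,x),y))$ for all $x,y\in V$. Put $\mathcal{C}^1(J)=J$ and $\mathcal{C}^{m+1}(J)=\varphi(\mathcal{C}^m(J),J)$ (linear span of products); $J$ is nilpotent if $\mathcal{C}^k(J)=\{0\}$ for some $k$. Fixing a basis $\{e_1,\dots,e_n\}$ of $\mathbb{C}^n$, a Jordan algebra law $\varphi$ on $\mathbb{C}^n$ is identified with its structure constants $(a_{ij}^k)\in\mathbb{C}^{n^3}$, $\varphi(e_i,e_j)=\sum_k a_{ij}^k e_k$. $\mathcal{J}^n\subset\mathbb{C}^{n^3}$ denotes the set of structure constants of all nilpotent Jordan algebra laws on $\mathbb{C}^n$ (including the Abelian law $\varphi\equiv 0$); since the Jordan identity and nilpotency are polynomial conditions, $\mathcal{J}^n$ is an algebraic variety, endowed with the Zariski topology. *)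

theory Defs
  imports "HOL-Analysis.Analysis" "HOL-Library.Poly_Mapping"
begin

text \<open>Polynomials in variables indexed by \<^typ>\<open>'i\<close>: finitely supported functions from exponent
  vectors to coefficients.\<close>

type_synonym 'i cpoly = "('i \<Rightarrow>\<^sub>0 nat) \<Rightarrow>\<^sub>0 complex"

definition eval_cpoly :: "('i::finite) cpoly \<Rightarrow> complex ^ 'i \<Rightarrow> complex" where
  "eval_cpoly p x =
    (\<Sum>m\<in>Poly_Mapping.keys p. Poly_Mapping.lookup p m * (\<Prod>i\<in>UNIV. (x $ i) ^ Poly_Mapping.lookup m i))"

definition zero_locus :: "('i::finite) cpoly set \<Rightarrow> (complex ^ 'i) set" where
  "zero_locus S = {x. \<forall>p\<in>S. eval_cpoly p x = 0}"

definition zariski :: "(complex ^ 'i::finite) topology" where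
  "zariski = topology (\<lambda>U. \<exists>S. U = - zero_locus S)"

lemma eval_cpoly_superset:
  assumes "finite K" "Poly_Mapping.keys p \<subseteq> K"
  shows "eval_cpoly p x =
    (\<Sum>m\<in>K. Poly_Mapping.lookup p m * (\<Prod>i\<in>UNIV. (x $ i) ^ Poly_Mapping.lookup m i))"
  unfolding eval_cpoly_def using assms
  by (intro sum.mono_neutral_left) (auto simp: in_keys_iff)

lemma eval_cpoly_add: "eval_cpoly (p + q) x = eval_cpoly p x + eval_cpoly q x"
proof -
  let ?K = "Poly_Mapping.keys p \<union> Poly_Mapping.keys q"
  have "Poly_Mapping.keys (p + q) \<subseteq> ?K" by (rule keys_add)
  then show ?thesis
    by (simp add: eval_cpoly_superset[of ?K] lookup_add sum.distrib distrib_right)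
qed

lemma eval_cpoly_single:
  "eval_cpoly (Poly_Mapping.single m c) x = c * (\<Prod>i\<in>UNIV. (x $ i) ^ Poly_Mapping.lookup m i)"
  by (subst eval_cpoly_superset[of "{m}"]) auto

lemma eval_cpoly_0: "eval_cpoly 0 x = 0"
  by (simp add: eval_cpoly_def)

lemma cpoly_induct [case_names zero add]:
  fixes p :: "'i cpoly"
  assumes "P 0" "\<And>m c q. P q \<Longrightarrow> P (Poly_Mapping.single m c + q)"
  shows "P p"
proof (induction p rule: Poly_Mapping.update_induct)
  case const
  show ?case by (rule assms(1))
next
  case (update f a b)
  have "Poly_Mapping.update a b f = Poly_Mapping.single a b + f"
    using update(1)
    by (intro poly_mapping_eqI) (auto simp: lookup_update lookup_add lookup_single when_def in_keys_iff)
  with assms(2)[OF update(3)] show ?case by simp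
qed

lemma eval_cpoly_mult: "eval_cpoly (p * q) x = eval_cpoly p x * eval_cpoly q x"
proof (induction p rule: cpoly_induct)
  case zero
  show ?case by (simp add: eval_cpoly_0)
next
  case (add m c p)
  have "eval_cpoly (Poly_Mapping.single m c * q) x = eval_cpoly (Poly_Mapping.single m c) x * eval_cpoly q x"
  proof (induction q rule: cpoly_induct)
    case zero
    show ?case by (simp add: eval_cpoly_0)
  next
    case (add n d q)
    then show ?case
      by (simp add: distrib_left eval_cpoly_add mult_single eval_cpoly_single lookup_add power_add
          prod.distrib mult_ac)
  qed
  with add show ?case
    by (simp add: distrib_right eval_cpoly_add)
qed

lemma zero_locus_Un: "zero_locus S \<union> zero_locus T = zero_locus {p * q | p q. p \<in> S \<and> q \<in> T}"
proof (intro set_eqI iffI)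
  fix x assume "x \<in> zero_locus S \<union> zero_locus T"
  then show "x \<in> zero_locus {p * q | p q. p \<in> S \<and> q \<in> T}"
    by (auto simp: zero_locus_def eval_cpoly_mult)
next
  fix x assume "x \<in> zero_locus {p * q | p q. p \<in> S \<and> q \<in> T}"
  then have "eval_cpoly p x * eval_cpoly q x = 0" if "p \<in> S" "q \<in> T" for p q
    using that unfolding zero_locus_def by (auto simp flip: eval_cpoly_mult)
  then show "x \<in> zero_locus S \<union> zero_locus T"
    unfolding zero_locus_def by fastforce
qed

lemma zero_locus_Inter: "(\<Inter>S\<in>F. zero_locus S) = zero_locus (\<Union>F)"
  by (auto simp: zero_locus_def)

lemma istopology_zariski: "istopology (\<lambda>U. \<exists>S. U = - zero_locus S)"
  unfolding istopology_def
proof (intro conjI allI impI)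
  fix U V :: "(complex ^ 'i) set"
  assume "\<exists>S. U = - zero_locus S" "\<exists>S. V = - zero_locus S"
  then obtain S T where "U = - zero_locus S" "V = - zero_locus T" by blast
  then have "U \<inter> V = - zero_locus {p * q | p q. p \<in> S \<and> q \<in> T}"
    by (simp flip: zero_locus_Un)
  then show "\<exists>S. U \<inter> V = - zero_locus S" by blast
next
  fix K :: "(complex ^ 'i) set set"
  assume "\<forall>U\<in>K. \<exists>S. U = - zero_locus S"
  then obtain S where S: "\<And>U. U \<in> K \<Longrightarrow> U = - zero_locus (S U)" by metis
  have "\<Union>K = - (\<Inter>T\<in>S ` K. zero_locus T)" using S by auto
  then show "\<exists>S. \<Union>K = - zero_locus S" unfolding zero_locus_Inter by blast
qed

lemma openin_zariski: "openin zariski U \<longleftrightarrow> (\<exists>S. U = - zero_locus S)"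
  unfolding zariski_def by (simp add: istopology_zariski)

lemma topspace_zariski [simp]: "topspace zariski = (UNIV :: (complex ^ 'i::finite) set)"
proof -
  have "- zero_locus {Poly_Mapping.single 0 1} = (UNIV :: (complex ^ 'i) set)"
    by (auto simp: zero_locus_def eval_cpoly_single simp del: single_one)
  then have "openin zariski (UNIV :: (complex ^ 'i) set)"
    unfolding openin_zariski by metis
  then show ?thesis
    using openin_subset by blast
qed

lemma closedin_zariski: "closedin zariski A \<longleftrightarrow> (\<exists>S. A = zero_locus S)"
proof -
  have "- A = - zero_locus S \<longleftrightarrow> A = zero_locus S" for S by auto
  then show ?thesis by (simp add: closedin_def openin_zariski flip: Compl_eq_Diff_UNIV)
qed

definition irreducible_space :: "'a topology \<Rightarrow> bool" where
  "irreducible_space X \<longleftrightarrow> topspace X \<noteq> {} \<and>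
    (\<forall>A B. closedin X A \<and> closedin X B \<and> A \<union> B = topspace X \<longrightarrow> A = topspace X \<or> B = topspace X)"

text \<open>Complex bilinearity is spelled out because \<^const>\<open>bilinear\<close> only means real bilinear.\<close>

definition jordan_law :: "(complex ^ 'n \<Rightarrow> complex ^ 'n \<Rightarrow> complex ^ 'n) \<Rightarrow> bool" where
  "jordan_law \<phi> \<longleftrightarrow>
    (\<forall>x. Vector_Spaces.linear (*s) (*s) (\<phi> x)) \<and>
    (\<forall>y. Vector_Spaces.linear (*s) (*s) (\<lambda>x. \<phi> x y)) \<and>
    (\<forall>x y. \<phi> x y = \<phi> y x) \<and>
    (\<forall>x y. \<phi> (\<phi> x x) (\<phi> x y) = \<phi> x (\<phi> (\<phi> x x) y))"

text \<open>The index is shifted by one: \<^term>\<open>central_series \<phi> m\<close> is $\mathcal{C}^{m+1}$.\<close>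

primrec central_series ::
    "(complex ^ 'n \<Rightarrow> complex ^ 'n \<Rightarrow> complex ^ 'n) \<Rightarrow> nat \<Rightarrow> (complex ^ 'n) set" where
  "central_series \<phi> 0 = UNIV"
| "central_series \<phi> (Suc m) = vec.span {\<phi> x y | x y. x \<in> central_series \<phi> m}"

definition nilpotent_law :: "(complex ^ 'n \<Rightarrow> complex ^ 'n \<Rightarrow> complex ^ 'n) \<Rightarrow> bool" where
  "nilpotent_law \<phi> \<longleftrightarrow> (\<exists>m. central_series \<phi> m = {0})"

definition structure_constants ::
    "(complex ^ 'n \<Rightarrow> complex ^ 'n \<Rightarrow> complex ^ 'n) \<Rightarrow> complex ^ ('n::finite \<times> 'n \<times> 'n)" where
  "structure_constants \<phi> = vec_lambda (\<lambda>(i, j, k). \<phi> (axis i 1) (axis j 1) $ k)"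

definition nilpotent_jordan_variety :: "(complex ^ ('n::finite \<times> 'n \<times> 'n)) set" where
  "nilpotent_jordan_variety = structure_constants ` {\<phi>. jordan_law \<phi> \<and> nilpotent_law \<phi>}"

end

theory Submission
  imports Defs
begin

text \<open>
  A nilpotent Jordan law in dimension three can be written, with \<open>\<times>\<close> the cross product and linear
  forms identified with their coefficient vectors, as
  \[ \varphi(x,y) = f(x) f(y)\, (f \times w) + (f(x) h(y) + h(x) f(y))\, (f \times h), \]
  and conversely every choice of \<open>f, h, w\<close> gives such a law. Hence the variety is the image of
  $\mathbb{C}^9$ under a polynomial map, and it inherits irreducibility from $\mathbb{C}^9$.

  All members of the family are nilpotent Jordan laws because products lie in the kernel of
  \<open>f\<close>, products with a product are multiples of \<open>f \<times> h\<close>, and \<open>f \<times> h\<close> annihilates everything; both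
  sides of the Jordan identity are therefore zero
  (\<open>family_law_jordan\<close>, \<open>family_law_nilpotent\<close>).

  For the converse (\<open>nilpotent_jordan_in_family\<close>), nilpotency gives a basis \<open>e\<^sub>1, e\<^sub>2, e\<^sub>3\<close> with
  \<open>e\<^sub>1 e\<^sub>1 = b e\<^sub>2 + a e\<^sub>3\<close>, \<open>e\<^sub>1 e\<^sub>2 = c e\<^sub>3\<close>, \<open>e\<^sub>2 e\<^sub>2 = d e\<^sub>3\<close> and \<open>e\<^sub>3\<close> annihilating everything.
  The Jordan identity at \<open>(e\<^sub>1, e\<^sub>1)\<close> reads \<open>b\<^sup>2 d = 0\<close>. The branches \<open>d = 0\<close> and \<open>b = 0\<close> look like two candidate
  components, but the first, \<open>d = 0\<close>, contains the second up to a change of basis: if \<open>b = 0\<close>, the law is a binary quadratic form with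
  values in the line of \<open>e\<^sub>3\<close>, which splits into linear factors over the complex numbers, so
  that an isotropic vector can take the place of \<open>e\<^sub>2\<close>.

  Finally, irreducibility of the image is checked on curves: two laws are joined, inside the variety,
  by the image of a line of parameters, and along this curve a product of two polynomials vanishes
  only if one of the factors does (\<open>irreducible_if_joined_by_polynomial_curves\<close>).
\<close>

section \<open>Irreducibility from polynomial curves\<close>

lemma eval_cpoly_on_curve:
  fixes c :: "'i::finite \<Rightarrow> complex poly"
  shows "\<exists>r. \<forall>t. eval_cpoly p (\<chi> i. poly (c i) t) = poly r t"
proof (intro exI allI)
  fix t
  show "eval_cpoly p (\<chi> i. poly (c i) t) =
    poly (\<Sum>m\<in>Poly_Mapping.keys p.
      smult (Poly_Mapping.lookup p m) (\<Prod>i\<in>UNIV. c i ^ Poly_Mapping.lookup m i)) t"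
    by (simp add: eval_cpoly_def poly_sum poly_prod)
qed

text \<open>If two proper closed subsets covered \<open>X\<close>, there would be an equation of the first failing at
  some \<open>x\<close> and an equation of the second failing at some \<open>y\<close>. Restricted to a curve from \<open>x\<close> to \<open>y\<close>
  inside \<open>X\<close>, both become nonzero polynomials in one variable whose product vanishes everywhere.\<close>

lemma irreducible_if_joined_by_polynomial_curves:
  fixes X :: "(complex ^ 'i::finite) set"
  assumes "X \<noteq> {}"
    and curve: "\<And>x y. x \<in> X \<Longrightarrow> y \<in> X \<Longrightarrow> \<exists>c :: 'i \<Rightarrow> complex poly.
      (\<forall>t. (\<chi> i. poly (c i) t) \<in> X) \<and> (\<chi> i. poly (c i) 0) = x \<and> (\<chi> i. poly (c i) 1) = y"
  shows "irreducible_space (subtopology zariski X)"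
  unfolding irreducible_space_def
proof (intro conjI allI impI)
  show "topspace (subtopology zariski X) \<noteq> {}" using assms(1) by simp
next
  fix A B
  assume AB: "closedin (subtopology zariski X) A \<and> closedin (subtopology zariski X) B
    \<and> A \<union> B = topspace (subtopology zariski X)"
  then obtain S T where A: "A = X \<inter> zero_locus S" and B: "B = X \<inter> zero_locus T"
    by (auto simp: closedin_subtopology closedin_zariski)
  have un: "A \<union> B = X" using AB by simp
  show "A = topspace (subtopology zariski X) \<or> B = topspace (subtopology zariski X)"
  proof (rule ccontr)
    assume "\<not> ?thesis"
    then obtain x y where x: "x \<in> X" "x \<notin> zero_locus S" and y: "y \<in> X" "y \<notin> zero_locus T"
      using A B by auto
    obtain p q where p: "p \<in> S" "eval_cpoly p x \<noteq> 0" and q: "q \<in> T" "eval_cpoly q y \<noteq> 0"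
      using x y by (auto simp: zero_locus_def)
    obtain c :: "'i \<Rightarrow> complex poly" where c: "\<And>t. (\<chi> i. poly (c i) t) \<in> X"
      "(\<chi> i. poly (c i) 0) = x" "(\<chi> i. poly (c i) 1) = y"
      using curve[OF x(1) y(1)] by blast
    obtain r where r: "\<And>t. eval_cpoly p (\<chi> i. poly (c i) t) = poly r t"
      using eval_cpoly_on_curve by metis
    obtain s where s: "\<And>t. eval_cpoly q (\<chi> i. poly (c i) t) = poly s t"
      using eval_cpoly_on_curve by metis
    have "poly (r * s) t = 0" for t
    proof -
      have "(\<chi> i. poly (c i) t) \<in> zero_locus S \<union> zero_locus T"
        using c(1)[of t] un A B by blast
      then show ?thesis using p(1) q(1) by (auto simp: zero_locus_def simp flip: r s)
    qed
    then have "r * s = 0" by (metis poly_all_0_iff_0)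
    moreover have "poly r 0 \<noteq> 0" "poly s 1 \<noteq> 0"
      using p(2) q(2) c(2,3) r[of 0] s[of 1] by simp_all
    ultimately show False by auto
  qed
qed

section \<open>A polynomial family of laws\<close>

text \<open>The constructions live over a commutative ring, so that the parameters can be complex numbers
  as well as the polynomials in \<open>t\<close> that describe a line of parameters. Since \<open>dot\<close> evaluates the
  linear form with given coefficients, it involves no complex conjugation.\<close>

definition dot :: "'a::comm_ring_1 ^ 3 \<Rightarrow> 'a ^ 3 \<Rightarrow> 'a" where
  "dot a x = (\<Sum>i\<in>UNIV. a $ i * x $ i)"

definition cross :: "'a::comm_ring_1 ^ 3 \<Rightarrow> 'a ^ 3 \<Rightarrow> 'a ^ 3" where
  "cross a b = vector [a$2 * b$3 - a$3 * b$2, a$3 * b$1 - a$1 * b$3, a$1 * b$2 - a$2 * b$1]"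

text \<open>A law of the shape \<open>f(x) f(y) u + (f(x) h(y) + h(x) f(y)) v\<close> is nilpotent Jordan as soon as
  \<open>f(u) = f(v) = h(v) = 0\<close>. Taking \<open>u = f \<times> w\<close> and \<open>v = f \<times> h\<close> solves these three equations
  polynomially and leaves the parameters \<open>f, h, w\<close> unconstrained.\<close>

definition family_law :: "'a::comm_ring_1 ^ 3 \<Rightarrow> 'a ^ 3 \<Rightarrow> 'a ^ 3 \<Rightarrow> 'a ^ 3 \<Rightarrow> 'a ^ 3 \<Rightarrow> 'a ^ 3" where
  "family_law f h w x y =
    (dot f x * dot f y) *s cross f w + (dot f x * dot h y + dot h x * dot f y) *s cross f h"

definition family_constants :: "'a::comm_ring_1 ^ 3 \<Rightarrow> 'a ^ 3 \<Rightarrow> 'a ^ 3 \<Rightarrow> 3 \<times> 3 \<times> 3 \<Rightarrow> 'a" where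
  "family_constants f h w = (\<lambda>(i, j, k). family_law f h w (axis i 1) (axis j 1) $ k)"

lemma dot_simps [simp]:
  "dot a (x + y) = dot a x + dot a y"
  "dot a (c *s x) = c * dot a x"
  "dot a 0 = 0"
  "dot a (axis i 1) = a $ i"
  by (simp_all add: dot_def axis_def if_distrib algebra_simps sum.distrib sum_distrib_left
      cong: if_cong)

lemma dot_cross [simp]: "dot a (cross a b) = 0" "dot b (cross a b) = 0"
  by (simp_all add: dot_def cross_def sum_3 algebra_simps)

lemma dot_family_law:
  "dot f (family_law f h w x y) = 0"
  "dot h (family_law f h w x y) = dot f x * dot f y * dot h (cross f w)"
  by (simp_all add: family_law_def)

text \<open>Both sides of the Jordan identity are zero: the left side is a product of two products, and \<open>f\<close>
  vanishes on products; on the right, \<open>x\<^sup>2 y\<close> is a multiple of \<open>f \<times> h\<close>, which annihilates everything.\<close>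

lemma family_law_jordan:
  fixes f h w :: "complex ^ 3"
  shows "jordan_law (family_law f h w)"
  unfolding jordan_law_def
proof (intro conjI allI)
  fix x y :: "complex ^ 3"
  show "Vector_Spaces.linear (*s) (*s) (family_law f h w x)"
    by unfold_locales (simp_all add: family_law_def algebra_simps vec.scale_left_distrib vec.scale_right_distrib)
  show "Vector_Spaces.linear (*s) (*s) (\<lambda>x. family_law f h w x y)"
    by unfold_locales (simp_all add: family_law_def algebra_simps)
  show "family_law f h w x y = family_law f h w y x"
    by (simp add: family_law_def algebra_simps)
  show "family_law f h w (family_law f h w x x) (family_law f h w x y) =
      family_law f h w x (family_law f h w (family_law f h w x x) y)"
    unfolding family_law_def[of f h w "family_law f h w x x"]
    by (simp add: dot_family_law) (simp add: family_law_def)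
qed

text \<open>The series descends through the kernel of \<open>f\<close> and the common kernel of \<open>f\<close> and \<open>h\<close>, whose
  elements annihilate everything.\<close>

lemma family_law_nilpotent:
  fixes f h w :: "complex ^ 3"
  shows "nilpotent_law (family_law f h w)"
proof -
  let ?C = "central_series (family_law f h w)"
  have "?C 1 \<subseteq> {z. dot f z = 0}"
    by (simp, intro vec.span_minimal vec.subspaceI) (auto simp: dot_family_law)
  then have "?C 2 \<subseteq> {z. dot f z = 0 \<and> dot h z = 0}"
    unfolding numeral_2_eq_2
    by (simp, intro vec.span_minimal vec.subspaceI) (auto simp: dot_family_law)
  then have "?C 3 \<subseteq> {0}"
    unfolding numeral_3_eq_3 numeral_2_eq_2 central_series.simps(2)[of _ "Suc (Suc 0)"]
    by (intro vec.span_minimal vec.subspaceI) (auto simp: family_law_def)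
  moreover have "0 \<in> ?C 3" by (simp add: numeral_3_eq_3 vec.span_zero)
  ultimately show ?thesis unfolding nilpotent_law_def by blast
qed

text \<open>Evaluation at \<open>t\<close> is a ring homomorphism, so it commutes with forming structure constants.
  This makes the image of a line of parameters a polynomial curve.\<close>

lemma poly_family_constants:
  fixes f h w :: "complex poly ^ 3"
  shows "poly (family_constants f h w i) t =
    family_constants (\<chi> i. poly (f $ i) t) (\<chi> i. poly (h $ i) t) (\<chi> i. poly (w $ i) t) i"
proof -
  obtain a b k where i: "i = (a, b, k)" by (cases i)
  have "\<forall>k. poly (cross x y $ k) t = cross (\<chi> i. poly (x $ i) t) (\<chi> i. poly (y $ i) t) $ k"
    for x y :: "complex poly ^ 3"
    by (simp add: forall_3 cross_def)
  then show ?thesis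
    by (simp add: i family_constants_def family_law_def)
qed

section \<open>Every nilpotent Jordan law belongs to the family\<close>

text \<open>A relative form of the fact that a nonzero nilpotent algebra has nonzero annihilator: \<open>z\<close>
  is found in the last term of the central series that is not yet contained in \<open>W\<close>. Applied to
  growing subspaces \<open>W\<close>, it produces a basis adapted to the multiplication.\<close>

lemma nilpotent_relative_annihilator:
  assumes "nilpotent_law \<phi>" "vec.subspace W" "W \<noteq> UNIV"
  shows "\<exists>z. z \<notin> W \<and> (\<forall>x. \<phi> z x \<in> W)"
proof -
  define m where "m = (LEAST m. central_series \<phi> m \<subseteq> W)"
  obtain k where "central_series \<phi> k = {0}" using assms(1) unfolding nilpotent_law_def by blast
  then have "central_series \<phi> k \<subseteq> W" using assms(2) by (simp add: vec.subspace_0)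
  then have m: "central_series \<phi> m \<subseteq> W" unfolding m_def by (rule LeastI)
  moreover have "m \<noteq> 0" using m assms(3) by (metis central_series.simps(1) top.extremum_uniqueI)
  then obtain n where n: "m = Suc n" by (cases m) auto
  then have "\<not> central_series \<phi> n \<subseteq> W" unfolding m_def by (metis lessI not_less_Least)
  then obtain z where z: "z \<in> central_series \<phi> n" "z \<notin> W" by blast
  have "\<phi> z x \<in> central_series \<phi> m" for x
    unfolding n central_series.simps by (rule vec.span_base) (use z in blast)
  then show ?thesis using z m by blast
qed

lemma linear_functional_eq_dot:
  fixes f :: "complex ^ 3 \<Rightarrow> complex"
  assumes "\<And>x y. f (x + y) = f x + f y" "\<And>c x. f (c *s x) = c * f x"
  shows "f x = dot (\<chi> i. f (axis i 1)) x"
proof -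
  have "x = x$1 *s axis 1 1 + x$2 *s axis 2 1 + x$3 *s axis 3 1"
    by (simp add: vec_eq_iff forall_3 axis_def)
  then have "f x = f (x$1 *s axis 1 1 + x$2 *s axis 2 1 + x$3 *s axis 3 1)" by simp
  then show ?thesis by (simp add: assms dot_def sum_3 mult.commute)
qed

text \<open>The coordinate forms of a basis, given by coefficient vectors; only those values that the
  constraints of the family refer to are recorded.\<close>

lemma basis_with_dual:
  fixes a b c :: "complex ^ 3"
  assumes "c \<noteq> 0" "b \<notin> vec.span {c}" "a \<notin> vec.span {b, c}"
  obtains p q r where "\<And>x. x = dot p x *s a + dot q x *s b + dot r x *s c"
    "dot p b = 0" "dot p c = 0" "dot q c = 0"
proof -
  have ind: "vec.independent {a, b, c}"
    using assms by (simp add: vec.independent_insert)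
  have dist: "a \<noteq> b" "a \<noteq> c" "b \<noteq> c"
    using assms by (auto intro: vec.span_base)
  have span: "vec.span {a, b, c} = UNIV"
    using vec.card_ge_dim_independent[of "{a,b,c}" UNIV] ind dist by (auto simp: vec_dim_card simp del: vec.dim_UNIV)
  define R where "R x = vec.representation {a, b, c} x" for x
  have add: "R (x + y) e = R x e + R y e" and scale: "R (k *s x) e = k * R x e" for x y k e
    using ind span by (simp_all add: R_def vec.representation_add vec.representation_scale)
  define p where "p e = (\<chi> i. R (axis i 1) e)" for e
  have R: "R x e = dot (p e) x" for x e
    unfolding p_def by (rule linear_functional_eq_dot) (simp_all add: add scale)
  have "R b a = 0" "R c a = 0" "R c b = 0"
    using ind dist by (simp_all add: R_def vec.representation_basis)
  moreover have "x = R x a *s a + R x b *s b + R x c *s c" for x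
    using vec.sum_representation_eq[OF ind, of x "{a,b,c}"] span dist
    by (simp add: R_def add.assoc)
  ultimately show ?thesis using that[of "p a" "p b" "p c"] by (simp add: R)
qed

text \<open>Division by \<open>f \<bullet> f\<close> is not possible, as a nonzero complex vector may be isotropic; therefore a
  nonzero coordinate of \<open>f\<close> is used as a pivot.\<close>

lemma orthogonal_imp_cross:
  fixes f u :: "complex ^ 3"
  assumes "f \<noteq> 0" "dot f u = 0"
  obtains w where "u = cross f w"
proof -
  have e: "f$1 * u$1 + f$2 * u$2 + f$3 * u$3 = 0" using assms(2) by (simp add: dot_def sum_3)
  have "f$1 \<noteq> 0 \<or> f$2 \<noteq> 0 \<or> f$3 \<noteq> 0" using assms(1) by (auto simp: vec_eq_iff forall_3)
  then consider "f$1 \<noteq> 0" | "f$2 \<noteq> 0" | "f$3 \<noteq> 0" by blast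
  then show ?thesis
  proof cases
    case 1
    then have "u = cross f (vector [0, u$3 / f$1, - u$2 / f$1])"
      using e by (simp add: vec_eq_iff forall_3 cross_def field_simps) algebra
    then show ?thesis by (rule that)
  next
    case 2
    then have "u = cross f (vector [- u$3 / f$2, 0, u$1 / f$2])"
      using e by (simp add: vec_eq_iff forall_3 cross_def field_simps) algebra
    then show ?thesis by (rule that)
  next
    case 3
    then have "u = cross f (vector [u$2 / f$3, - u$1 / f$3, 0])"
      using e by (simp add: vec_eq_iff forall_3 cross_def field_simps) algebra
    then show ?thesis by (rule that)
  qed
qed

lemma parallel_if_cross_zero:
  fixes f g :: "complex ^ 3"
  assumes "f \<noteq> 0" "cross f g = 0"
  obtains k where "g = k *s f"
proof -
  have e: "f$2 * g$3 = f$3 * g$2" "f$3 * g$1 = f$1 * g$3" "f$1 * g$2 = f$2 * g$1"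
    using assms(2) by (simp_all add: vec_eq_iff forall_3 cross_def)
  have "f$1 \<noteq> 0 \<or> f$2 \<noteq> 0 \<or> f$3 \<noteq> 0" using assms(1) by (auto simp: vec_eq_iff forall_3)
  then obtain i where i: "f $ i \<noteq> 0" by blast
  have "\<forall>i j. f $ i * g $ j = f $ j * g $ i" using e by (simp add: forall_3)
  then have "g = (g $ i / f $ i) *s f" using i by (simp add: vec_eq_iff field_simps)
  then show ?thesis by (rule that)
qed

lemma cross_cross:
  "cross (cross f g) v = dot f v *s g - dot g v *s f"
  by (simp add: vec_eq_iff forall_3 cross_def dot_def sum_3 algebra_simps)

text \<open>Here the constraints on \<open>u\<close> and \<open>v\<close> are solved by cross products, with \<open>f \<noteq> 0\<close>
  since otherwise the law is zero. If \<open>f\<close> and \<open>g\<close> are independent, then \<open>v = k (f \<times> g)\<close>, and the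
  scalar \<open>k\<close> is absorbed by rescaling \<open>g\<close> with a square root of \<open>k\<close>, because \<open>g\<close> enters the second summand of the family quadratically. If they are
  dependent, the second summand is itself a multiple of \<open>f(x) f(y)\<close> and is merged into \<open>u\<close>.\<close>

lemma normal_form_in_family:
  fixes f g u v :: "complex ^ 3"
  assumes \<phi>: "\<And>x y. \<phi> x y = (dot f x * dot f y) *s u + (dot f x * dot g y + dot g x * dot f y) *s v"
    and fu: "dot f u = 0" and fv: "dot f v = 0" and gv: "dot g v = 0"
  shows "\<exists>f h w. \<phi> = family_law f h w"
proof (cases "f = 0")
  case True
  then have "\<phi> = family_law 0 0 0" by (intro ext) (simp add: \<phi> family_law_def dot_def)
  then show ?thesis by blast
next
  case f: False
  show ?thesis
  proof (cases "cross f g = 0")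
    case True
    then obtain k where g: "g = k *s f" using f parallel_if_cross_zero by blast
    \<comment> \<open>Both mixed terms equal \<open>k f(x) f(y)\<close>, hence the factor two.\<close>
    have "dot f (u + (2 * k) *s v) = 0" using fu fv by simp
    then obtain w where w: "u + (2 * k) *s v = cross f w" using f orthogonal_imp_cross by blast
    have dg: "dot g x = k * dot f x" for x by (simp add: g dot_def sum_distrib_left mult.assoc)
    have "\<phi> = family_law f 0 w"
      by (intro ext) (simp add: \<phi> family_law_def dg flip: w, simp add: dot_def vec_eq_iff algebra_simps)
    then show ?thesis by blast
  next
    case False
    obtain w where w: "u = cross f w" using f fu orthogonal_imp_cross by blast
    \<comment> \<open>The vector \<open>(f \<times> g) \<times> v\<close> expands to \<open>f(v) g - g(v) f = 0\<close>.\<close>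
    obtain k where k: "v = k *s cross f g"
      using parallel_if_cross_zero[OF False, of v] by (auto simp: cross_cross fv gv)
    have "\<phi> = family_law f (csqrt k *s g) w"
    proof (intro ext)
      fix x y
      have cross: "cross f (csqrt k *s g) = csqrt k *s cross f g"
        by (simp add: vec_eq_iff forall_3 cross_def algebra_simps)
      have dot: "dot (csqrt k *s g) x = csqrt k * dot g x" for x
        by (simp add: dot_def sum_distrib_left mult.assoc)
      have sqrt: "csqrt k * csqrt k = k"
        by (metis power2_csqrt power2_eq_square)
      have "family_law f (csqrt k *s g) w x y = (dot f x * dot f y) *s u
          + (csqrt k * csqrt k * (dot f x * dot g y + dot g x * dot f y)) *s cross f g"
        by (simp add: family_law_def cross dot w vec_eq_iff) (simp add: algebra_simps)
      then show "\<phi> x y = family_law f (csqrt k *s g) w x y"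
        by (simp add: \<phi> k sqrt mult.commute)
    qed
    then show ?thesis by blast
  qed
qed

text \<open>The numbers \<open>r\<close> and \<open>s\<close> are the roots of \<open>d X\<^sup>2 + 2 c X + a\<close>, so that
  \<open>a X\<^sup>2 + 2 c X Y + d Y\<^sup>2 = d (Y - r X) (Y - s X)\<close>.\<close>

lemma binary_quadratic_form_factors:
  fixes a c d :: complex
  assumes "d \<noteq> 0"
  obtains r s where "r + s = - 2 * c / d" "r * s = a / d"
proof -
  define e where "e = csqrt (c\<^sup>2 - a * d)"
  have "e\<^sup>2 = c\<^sup>2 - a * d" unfolding e_def by (rule power2_csqrt)
  then have "(- c + e) * (- c - e) = a * d" by algebra
  then have "(- c + e) / d * ((- c - e) / d) = a / d"
    using assms by (simp add: divide_simps)
  moreover have "(- c + e) / d + (- c - e) / d = - 2 * c / d"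
    by (simp flip: add_divide_distrib)
  ultimately show ?thesis using that by blast
qed

text \<open>In a basis adapted to the multiplication, the law is in the shape of
  \<open>normal_form_in_family\<close> when \<open>d = 0\<close>; in the other case allowed by the Jordan identity, factoring
  the remaining quadratic form brings it into that shape with \<open>u = 0\<close>.\<close>

lemma nilpotent_jordan_in_family:
  fixes \<phi> :: "complex ^ 3 \<Rightarrow> complex ^ 3 \<Rightarrow> complex ^ 3"
  assumes J: "jordan_law \<phi>" and N: "nilpotent_law \<phi>"
  shows "\<exists>f h w. \<phi> = family_law f h w"
proof -
  have lin: "Vector_Spaces.linear (*s) (*s) (\<phi> x)" "Vector_Spaces.linear (*s) (*s) (\<lambda>y. \<phi> y x)" for x
    using J by (auto simp: jordan_law_def)
  have add: "\<phi> x (y + z) = \<phi> x y + \<phi> x z" "\<phi> (y + z) x = \<phi> y x + \<phi> z x" for x y z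
    using lin[of x] by (simp_all add: Vector_Spaces.linear_iff)
  have scale: "\<phi> x (k *s y) = k *s \<phi> x y" "\<phi> (k *s y) x = k *s \<phi> y x" for x y k
    using lin[of x] by (simp_all add: Vector_Spaces.linear_iff)
  have comm: "\<phi> x y = \<phi> y x" for x y using J by (auto simp: jordan_law_def)
  have jid: "\<phi> (\<phi> x x) (\<phi> x y) = \<phi> x (\<phi> (\<phi> x x) y)" for x y using J by (auto simp: jordan_law_def)
  have proper: "vec.span S \<noteq> UNIV" if "finite S" "card S < 3" for S :: "(complex ^ 3) set"
  proof
    assume "vec.span S = UNIV"
    then have "vec.dim (UNIV :: (complex ^ 3) set) \<le> card S"
      using vec.dim_le_card[of UNIV S] that(1) by simp
    then show False using that(2) by (simp add: vec_dim_card del: vec.dim_UNIV)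
  qed
  obtain e3 where e3: "e3 \<noteq> 0" "\<And>x. \<phi> e3 x = 0"
    using nilpotent_relative_annihilator[OF N, of "vec.span {}"] proper[of "{}"] by auto
  obtain e2 where e2: "e2 \<notin> vec.span {e3}" "\<And>x. \<phi> e2 x \<in> vec.span {e3}"
    using nilpotent_relative_annihilator[OF N vec.subspace_span, of "{e3}"] proper[of "{e3}"] by auto
  obtain e1 where e1: "e1 \<notin> vec.span {e2, e3}" "\<And>x. \<phi> e1 x \<in> vec.span {e2, e3}"
    using nilpotent_relative_annihilator[OF N vec.subspace_span, of "{e2, e3}"] proper[of "{e2, e3}"]
    by (auto simp: card_insert_if)
  obtain p q r where x: "\<And>x. x = dot p x *s e1 + dot q x *s e2 + dot r x *s e3"
    and dual: "dot p e2 = 0" "dot p e3 = 0" "dot q e3 = 0"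
    using basis_with_dual[OF e3(1) e2(1) e1(1)] by metis
  have line: "\<exists>k. z = k *s e3" if "z \<in> vec.span {e3}" for z
    using that by (auto simp: vec.span_singleton)
  obtain c where c: "\<phi> e2 e1 = c *s e3" using line[OF e2(2)] by blast
  obtain d where d: "\<phi> e2 e2 = d *s e3" using line[OF e2(2)] by blast
  obtain a b where ab: "\<phi> e1 e1 = b *s e2 + a *s e3"
  proof -
    obtain b where "\<phi> e1 e1 - b *s e2 \<in> vec.span {e3}"
      using e1(2)[of e1] by (auto simp: vec.span_insert)
    then obtain a where "\<phi> e1 e1 - b *s e2 = a *s e3" using line by blast
    then show ?thesis using that[of b a] by (simp add: diff_eq_eq add.commute)
  qed
  have prods: "\<phi> e1 e2 = c *s e3" "\<phi> x e3 = 0" for x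
    using comm c e3(2) by metis+
  have expand: "\<phi> x y = (dot p x * dot p y) *s (b *s e2 + a *s e3)
      + (c * (dot p x * dot q y + dot q x * dot p y) + d * (dot q x * dot q y)) *s e3" for x y
  proof -
    have "\<phi> x y = \<phi> (dot p x *s e1 + dot q x *s e2 + dot r x *s e3) (dot p y *s e1 + dot q y *s e2 + dot r y *s e3)"
      using x[of x] x[of y] by simp
    then show ?thesis by (simp add: add scale prods c d ab e3(2) vec_eq_iff algebra_simps)
  qed
  \<comment> \<open>For \<open>x = y = e1\<close> the left side of the Jordan identity is \<open>(b e2)(b e2)\<close> and the right side is
    \<open>e1 (b c e3) = 0\<close>.\<close>
  have "(b * b * d) *s e3 = 0"
    using jid[of e1 e1] by (simp add: add scale prods c d ab e3(2) mult.assoc)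
  then consider "d = 0" | "d \<noteq> 0" "b = 0" using e3(1) by auto
  then show ?thesis
  proof cases
    case 1
    have "\<phi> x y = (dot p x * dot p y) *s (b *s e2 + a *s e3)
      + (dot p x * dot q y + dot q x * dot p y) *s (c *s e3)" for x y
      unfolding expand by (simp add: 1 vec_eq_iff)
    then show ?thesis by (rule normal_form_in_family) (simp_all add: dual)
  next
    case 2
    obtain k l where kl: "k + l = - 2 * c / d" "k * l = a / d"
      using binary_quadratic_form_factors[OF 2(1)] by blast
    have cc: "c = - (d / 2) * (k + l)" and aa: "a = d * (k * l)" using 2 kl by (simp_all add: field_simps)
    \<comment> \<open>These forms polarise the factorisation of the quadratic form; the factor \<open>d / 2\<close> accounts for the
      two mixed terms \<open>f(x) g(y)\<close> and \<open>g(x) f(y)\<close>.\<close>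
    define f where "f = q - k *s p"
    define g where "g = (d / 2) *s (q - l *s p)"
    have f: "dot f x = dot q x - k * dot p x" and g: "dot g x = d / 2 * (dot q x - l * dot p x)" for x
      by (simp_all add: f_def g_def dot_def sum_3 algebra_simps)
    have "\<phi> x y = (dot f x * dot f y) *s 0 + (dot f x * dot g y + dot g x * dot f y) *s e3" for x y
      unfolding expand by (simp add: 2 vec_eq_iff f g cc aa field_simps)
    then show ?thesis by (rule normal_form_in_family) (simp_all add: f g dual)
  qed
qed

lemma variety_eq_family:
  "nilpotent_jordan_variety = {\<chi> i. family_constants f h w i | f h w. True}"
proof -
  have sc: "structure_constants (family_law f h w) = (\<chi> i. family_constants f h w i)"
    for f h w :: "complex ^ 3"
    by (simp add: structure_constants_def family_constants_def)
  have "{\<phi>. jordan_law \<phi> \<and> nilpotent_law \<phi>} = {family_law f h w | f h w :: complex ^ 3. True}"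
    using nilpotent_jordan_in_family family_law_jordan family_law_nilpotent by blast
  then show ?thesis
    unfolding nilpotent_jordan_variety_def sc[symmetric] by auto
qed

theorem theorem2p2:
  shows "irreducible_space
    (subtopology zariski (nilpotent_jordan_variety :: (complex ^ (3 \<times> 3 \<times> 3)) set))"
proof (rule irreducible_if_joined_by_polynomial_curves)
  show "(nilpotent_jordan_variety :: (complex ^ (3 \<times> 3 \<times> 3)) set) \<noteq> {}"
    unfolding variety_eq_family by blast
next
  fix x y :: "complex ^ (3 \<times> 3 \<times> 3)"
  assume "x \<in> nilpotent_jordan_variety" "y \<in> nilpotent_jordan_variety"
  then obtain f h w f' h' w' where x: "x = (\<chi> i. family_constants f h w i)"
    and y: "y = (\<chi> i. family_constants f' h' w' i)"
    unfolding variety_eq_family by blast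
  \<comment> \<open>The curve is the image of the straight line from \<open>(f, h, w)\<close> to \<open>(f', h', w')\<close>.\<close>
  define line :: "complex ^ 3 \<Rightarrow> complex ^ 3 \<Rightarrow> complex poly ^ 3"
    where "line a b = (\<chi> i. [:a $ i, b $ i - a $ i:])" for a b
  define c where "c = family_constants (line f f') (line h h') (line w w')"
  have ends: "(\<chi> i. poly (line a b $ i) 0) = a" "(\<chi> i. poly (line a b $ i) 1) = b" for a b
    by (simp_all add: line_def)
  have "(\<chi> i. poly (c i) t) \<in> nilpotent_jordan_variety" for t
    unfolding c_def poly_family_constants variety_eq_family by blast
  moreover have "(\<chi> i. poly (c i) 0) = x" "(\<chi> i. poly (c i) 1) = y"
    unfolding c_def poly_family_constants ends x y by simp_all
  ultimately show "\<exists>c. (\<forall>t. (\<chi> i. poly (c i) t) \<in> nilpotent_jordan_variety)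
      \<and> (\<chi> i. poly (c i) 0) = x \<and> (\<chi> i. poly (c i) 1) = y"
    by blast
qed

end
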